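(* Let $T\in\mathbb{N}$, let $\mathcal{X},\mathcal{U},\mathcal{Y}$ be Polish spaces, and let $f:\mathcal{X}\times\mathcal{U}\to\mathcal{X}$ and $h:\mathcal{X}\times\mathcal{U}\to\mathcal{Y}$ be continuous. Then the extreme points of the behavioral-measure set $\mathcal{M}_{\mathcal{B}}$ are precisely the Dirac masses $\delta_\omega$ with $\omega\in\mathfrak{B}_T$.
   Context: For a Polish space $S$, $\mathcal{P}(S)$ denotes the set of Borel probability measures on $S$. The trajectory space is $\Omega_T:=\mathcal{X}^{T+1}\times\mathcal{U}^T\times\mathcal{Y}^T$ with its product topology and Borel $\sigma$-algebra. For $\omega=(x_{0:T},u_{0:T-1},y_{0:T-1})\in\Omega_T$ the coordinate maps are $X_t(\omega)=x_t$, $U_t(\omega)=u_t$, $Y_t(\omega)=y_t$. The admissible path set is $$\mathfrak{B}_T:=\{\omega\in\Omega_T: X_{t+1}(\omega)=f(X_t(\omega),U_t(\omega)),\ Y_t(\omega)=h(X_t(\omega),U_t(\omega)),\ t=0,\dots,T-1\}.$$ The behavioral-measure set is $\mathcal{M}_{\mathcal{B}}:=\{\mu\in\mathcal{P}(\Omega_T):\mu(\mathfrak{B}_T)=1\}$. *)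

theory Defs
  imports "HOL-Probability.Probability"
begin

definition borel_of_topology :: "'a topology \<Rightarrow> 'a measure" where
  "borel_of_topology X = sigma (topspace X) {U. openin X U}"

definition borel_probability_measures :: "'a topology \<Rightarrow> 'a measure set" where
  "borel_probability_measures X = space (prob_algebra (borel_of_topology X))"

text \<open>
  Measures do not form a vector space type, so the library's \<^const>\<open>extreme_point_of\<close>
  does not apply; convex combinations are taken setwise. The formula is meant for sets \<open>S\<close> of
  probability measures on one common \<open>\<sigma>\<close>-algebra, so that \<open>sets \<mu>\<close> is the \<open>\<sigma>\<close>-algebra
  of all measures involved.
\<close>

definition is_convex_combination ::
    "'a measure \<Rightarrow> real \<Rightarrow> 'a measure \<Rightarrow> 'a measure \<Rightarrow> bool" where
  "is_convex_combination \<mu> t \<mu>1 \<mu>2 \<longleftrightarrow>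
     (\<forall>A\<in>sets \<mu>. measure \<mu> A = t * measure \<mu>1 A + (1 - t) * measure \<mu>2 A)"

definition extreme_measures :: "'a measure set \<Rightarrow> 'a measure set" where
  "extreme_measures S =
     {\<mu>\<in>S. \<forall>\<mu>1\<in>S. \<forall>\<mu>2\<in>S. \<forall>t. 0 < t \<and> t < 1 \<and> is_convex_combination \<mu> t \<mu>1 \<mu>2
        \<longrightarrow> \<mu>1 = \<mu> \<and> \<mu>2 = \<mu>}"

text \<open>
  A trajectory is a triple \<open>(x, u, y)\<close> of functions on the natural numbers. Finite sequences are
  encoded by extensionality: every point of the topological space below is \<open>undefined\<close> outside
  the index set of the respective component, so the components range exactly over the finite
  powers with exponents \<open>T + 1\<close>, \<open>T\<close> and \<open>T\<close>.
\<close>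

type_synonym ('x, 'u, 'y) trajectory = "(nat \<Rightarrow> 'x) \<times> (nat \<Rightarrow> 'u) \<times> (nat \<Rightarrow> 'y)"

definition trajectory_topology ::
    "nat \<Rightarrow> ('x::topological_space, 'u::topological_space, 'y::topological_space) trajectory topology"
  where
  "trajectory_topology T =
     prod_topology (product_topology (\<lambda>_. euclidean) {0..T})
       (prod_topology (product_topology (\<lambda>_. euclidean) {0..<T})
                      (product_topology (\<lambda>_. euclidean) {0..<T}))"

definition state_at :: "nat \<Rightarrow> ('x, 'u, 'y) trajectory \<Rightarrow> 'x" where
  "state_at t \<omega> = fst \<omega> t"

definition input_at :: "nat \<Rightarrow> ('x, 'u, 'y) trajectory \<Rightarrow> 'u" where
  "input_at t \<omega> = fst (snd \<omega>) t"

definition output_at :: "nat \<Rightarrow> ('x, 'u, 'y) trajectory \<Rightarrow> 'y" where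
  "output_at t \<omega> = snd (snd \<omega>) t"

definition admissible_paths ::
    "nat \<Rightarrow> ('x::topological_space \<times> 'u::topological_space \<Rightarrow> 'x) \<Rightarrow>
     ('x \<times> 'u \<Rightarrow> 'y::topological_space) \<Rightarrow> ('x, 'u, 'y) trajectory set" where
  "admissible_paths T f h =
     {\<omega> \<in> topspace (trajectory_topology T).
        \<forall>t<T. state_at (Suc t) \<omega> = f (state_at t \<omega>, input_at t \<omega>) \<and>
              output_at t \<omega> = h (state_at t \<omega>, input_at t \<omega>)}"

definition behavioral_measures ::
    "nat \<Rightarrow> ('x::topological_space \<times> 'u::topological_space \<Rightarrow> 'x) \<Rightarrow>
     ('x \<times> 'u \<Rightarrow> 'y::topological_space) \<Rightarrow> ('x, 'u, 'y) trajectory measure set" where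
  "behavioral_measures T f h =
     {\<mu> \<in> borel_probability_measures (trajectory_topology T).
        emeasure \<mu> (admissible_paths T f h) = 1}"

end

theory Submission
  imports Defs
begin

text \<open>
  The argument is a statement about probability measures on a measurable space \<open>M\<close> that are
  concentrated on a fixed measurable set \<open>B\<close>. Splitting such a measure \<open>\<mu>\<close> along an event \<open>A\<close>
  writes it as a convex combination of its conditional distributions given \<open>A\<close> and given the
  complement of \<open>A\<close>, which are again concentrated on \<open>B\<close>. The two parts differ as soon as
  \<open>0 < \<mu> A < 1\<close>, so an extreme \<open>\<mu>\<close> takes only the values 0 and 1
  (\<open>extreme_measure_zero_one\<close>). If countably many measurable sets separate the points of \<open>M\<close>, then
  almost every point lies in exactly those separating sets that have full measure; two points with
  this property coincide, so \<open>\<mu>\<close> is a Dirac mass (\<open>zero_one_measure_is_return\<close>), and its atom lies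
  in \<open>B\<close>. Conversely, a Dirac mass takes only the extreme values of the interval from 0 to 1, so
  both parts of a convex decomposition must agree with it on every event
  (\<open>convex_combination_return\<close>).

  For trajectories, the coordinate preimages of countable bases of the three factor spaces separate
  points, since a trajectory is determined by finitely many coordinates. The admissible paths form a
  closed, hence measurable, set because they are cut out by finitely many equations between
  continuous functions with values in Hausdorff spaces.
\<close>

section \<open>Extreme points among probability measures concentrated on a set\<close>

text \<open>
  Countability is what allows the null sets belonging to the individual members of the separating
  family to be discarded simultaneously, so that a single candidate for the atom survives.
\<close>

lemma zero_one_measure_is_return:
  assumes "prob_space M"
    and "countable C" and "C \<subseteq> sets M"
    and separating: "\<And>x y. x \<in> space M \<Longrightarrow> y \<in> space M \<Longrightarrow> x \<noteq> y \<Longrightarrow> \<exists>U\<in>C. (x \<in> U) \<noteq> (y \<in> U)"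
    and zero_one: "\<And>A. A \<in> sets M \<Longrightarrow> measure M A = 0 \<or> measure M A = 1"
  shows "\<exists>\<omega>\<in>space M. M = return M \<omega>"
proof -
  interpret prob_space M by fact
  define typical where "typical x \<longleftrightarrow> (\<forall>U\<in>C. x \<in> U \<longleftrightarrow> prob U = 1)" for x
  have "AE x in M. x \<in> U \<longleftrightarrow> prob U = 1" if "U \<in> C" for U
  proof -
    have U: "U \<in> sets M" using that assms(3) by auto
    from zero_one[OF U] show ?thesis
    proof
      assume null: "prob U = 0"
      then have "AE x in M. x \<notin> U" using prob_eq_0[OF U] by simp
      then show ?thesis using null by simp
    next
      assume full: "prob U = 1"
      then have "AE x in M. x \<in> U" using prob_eq_1[OF U] by simp
      then show ?thesis using full by simp
    qed
  qed
  then have AE_typical: "AE x in M. typical x"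
    unfolding typical_def using \<open>countable C\<close> by (intro AE_ball_countable') auto
  then have "AE x in M. typical x \<and> x \<in> space M" using AE_space by eventually_elim simp
  then obtain \<omega> where \<omega>: "\<omega> \<in> space M" "typical \<omega>"
    using eventually_happens[of "\<lambda>x. typical x \<and> x \<in> space M" "ae_filter M"] ae_filter_bot
    by auto
  have AE_eq: "AE x in M. x = \<omega>"
    using AE_typical AE_space
  proof eventually_elim
    case (elim x)
    then show ?case using separating[of x \<omega>] \<omega> unfolding typical_def by blast
  qed
  have "M = return M \<omega>"
  proof (rule measure_eqI)
    fix A assume A: "A \<in> sets M"
    have "emeasure M A = indicator A \<omega>"
    proof (cases "\<omega> \<in> A")
      case True
      have "AE x in M. x \<in> A" using AE_eq by eventually_elim (use True in simp)
      then have "prob A = 1" using prob_eq_1[OF A] by simp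
      then show ?thesis using True by (simp add: emeasure_eq_measure)
    next
      case False
      have "AE x in M. x \<notin> A" using AE_eq by eventually_elim (use False in auto)
      then have "prob A = 0" using prob_eq_0[OF A] by simp
      then show ?thesis using False by (simp add: emeasure_eq_measure)
    qed
    then show "emeasure M A = emeasure (return M \<omega>) A" using A by simp
  qed simp
  then show ?thesis using \<omega> by blast
qed

text \<open>
  Conditioning on a non-null event preserves almost sure properties, so the conditional
  distributions remain competitors in the definition of an extreme measure.
\<close>

lemma uniform_measure_concentrated:
  assumes "\<mu> \<in> space (prob_algebra M)" and B: "B \<in> sets M" "emeasure \<mu> B = 1"
    and A: "A \<in> sets M" "measure \<mu> A \<noteq> 0"
  shows "uniform_measure \<mu> A \<in> {\<mu> \<in> space (prob_algebra M). emeasure \<mu> B = 1}"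
proof -
  have sets_eq: "sets \<mu> = sets M" and "prob_space \<mu>"
    using assms(1) by (auto simp: space_prob_algebra)
  interpret prob_space \<mu> by fact
  have pos: "emeasure \<mu> A \<noteq> 0" using A(2) by (simp add: emeasure_eq_measure)
  interpret cond: prob_space "uniform_measure \<mu> A"
    by (rule prob_space_uniform_measure) (use pos in auto)
  have "AE x in \<mu>. x \<in> B" using B sets_eq prob_eq_1[of B] by (simp add: emeasure_eq_measure)
  then have "AE x in uniform_measure \<mu> A. x \<in> B"
    using A sets_eq by (intro AE_uniform_measureI) auto
  then have "emeasure (uniform_measure \<mu> A) B = 1"
    using cond.prob_eq_1[of B] B sets_eq by (simp add: cond.emeasure_eq_measure)
  then show ?thesis using sets_eq cond.prob_space_axioms by (simp add: space_prob_algebra)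
qed

text \<open>
  The law of total probability exhibits \<open>\<mu>\<close> as a convex combination of its conditional
  distributions given an event and given its complement, with weight the probability of the event.
  If \<open>\<mu>\<close> is extreme it equals the former, which gives the event probability 1.
\<close>

lemma extreme_measure_zero_one:
  assumes extreme: "\<mu> \<in> extreme_measures {\<mu> \<in> space (prob_algebra M). emeasure \<mu> B = 1}"
    and B: "B \<in> sets M" and A: "A \<in> sets M"
  shows "measure \<mu> A = 0 \<or> measure \<mu> A = 1"
proof (rule ccontr)
  assume contr: "\<not> (measure \<mu> A = 0 \<or> measure \<mu> A = 1)"
  let ?A' = "space \<mu> - A"
  have mem: "\<mu> \<in> space (prob_algebra M)" "emeasure \<mu> B = 1"
    using extreme by (auto simp: extreme_measures_def)
  then have sets_eq: "sets \<mu> = sets M" and "prob_space \<mu>"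
    by (auto simp: space_prob_algebra)
  interpret prob_space \<mu> by fact
  have A\<mu>: "A \<in> sets \<mu>" "?A' \<in> sets \<mu>" using A sets_eq by auto
  have compl: "prob ?A' = 1 - prob A" using A\<mu> by (simp add: prob_compl)
  have t: "0 < prob A" "prob A < 1"
    using contr prob_le_1[of A] measure_nonneg[of \<mu> A] by linarith+
  have cond: "measure (uniform_measure \<mu> D) E = prob (D \<inter> E) / prob D"
    if "D \<in> sets \<mu>" "E \<in> sets \<mu>" "prob D \<noteq> 0" for D E
    using that by (intro measure_uniform_measure) (auto simp: emeasure_eq_measure)
  have "is_convex_combination \<mu> (prob A) (uniform_measure \<mu> A) (uniform_measure \<mu> ?A')"
    unfolding is_convex_combination_def
  proof
    fix E assume E: "E \<in> sets \<mu>"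
    have "prob E = prob (A \<inter> E) + prob (?A' \<inter> E)"
    proof -
      have "E = (A \<inter> E) \<union> (?A' \<inter> E)" using sets.sets_into_space[OF E] by auto
      then show ?thesis
        using finite_measure_Union[of "A \<inter> E" "?A' \<inter> E"] A\<mu> E by auto
    qed
    then show "prob E = prob A * measure (uniform_measure \<mu> A) E
        + (1 - prob A) * measure (uniform_measure \<mu> ?A') E"
      using t A\<mu> E by (simp add: cond compl)
  qed
  moreover have "uniform_measure \<mu> A \<in> {\<mu> \<in> space (prob_algebra M). emeasure \<mu> B = 1}"
    using uniform_measure_concentrated[OF mem(1) B mem(2) A] t by simp
  moreover have "uniform_measure \<mu> ?A' \<in> {\<mu> \<in> space (prob_algebra M). emeasure \<mu> B = 1}"
    using uniform_measure_concentrated[OF mem(1) B mem(2), of ?A'] t compl A\<mu> sets_eq by simp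
  ultimately have "uniform_measure \<mu> A = \<mu>"
    using extreme t unfolding extreme_measures_def by blast
  then have "prob A = 1" using cond[of A A] A\<mu> t by simp
  then show False using t by simp
qed

text \<open>
  The values 0 and 1 of a Dirac mass are extreme in the range of a probability measure, so each
  event can only be split trivially.
\<close>

lemma convex_combination_return:
  assumes "\<omega> \<in> space M" and "\<mu>1 \<in> space (prob_algebra M)" and "\<mu>2 \<in> space (prob_algebra M)"
    and t: "0 < t" "t < 1"
    and comb: "is_convex_combination (return M \<omega>) t \<mu>1 \<mu>2"
  shows "\<mu>1 = return M \<omega> \<and> \<mu>2 = return M \<omega>"
proof -
  have sets_eq: "sets \<mu>1 = sets M" "sets \<mu>2 = sets M" and "prob_space \<mu>1" "prob_space \<mu>2"
    using assms by (auto simp: space_prob_algebra)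
  interpret P1: prob_space \<mu>1 by fact
  interpret P2: prob_space \<mu>2 by fact
  have prob_eq: "P1.prob A = indicator A \<omega> \<and> P2.prob A = indicator A \<omega>" if A: "A \<in> sets M" for A
  proof -
    have sum: "indicator A \<omega> = t * P1.prob A + (1 - t) * P2.prob A"
      using comb A by (simp add: is_convex_combination_def measure_return)
    show ?thesis
    proof (cases "\<omega> \<in> A")
      case True
      have "t * (1 - P1.prob A) + (1 - t) * (1 - P2.prob A) = 0"
        using sum True by (simp add: algebra_simps)
      moreover have "0 \<le> t * (1 - P1.prob A)" "0 \<le> (1 - t) * (1 - P2.prob A)"
        using t by auto
      ultimately have "t * (1 - P1.prob A) = 0" "(1 - t) * (1 - P2.prob A) = 0" by linarith+
      then show ?thesis using t True by simp
    next
      case False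
      have "0 \<le> t * P1.prob A" "0 \<le> (1 - t) * P2.prob A" using t by auto
      moreover have "t * P1.prob A + (1 - t) * P2.prob A = 0" using sum False by simp
      ultimately have "t * P1.prob A = 0" "(1 - t) * P2.prob A = 0" by linarith+
      then show ?thesis using t False by simp
    qed
  qed
  have "\<mu>1 = return M \<omega>"
    using sets_eq prob_eq
    by (intro measure_eqI) (auto simp: P1.emeasure_eq_measure split: split_indicator)
  moreover have "\<mu>2 = return M \<omega>"
    using sets_eq prob_eq
    by (intro measure_eqI) (auto simp: P2.emeasure_eq_measure split: split_indicator)
  ultimately show ?thesis by simp
qed

text \<open>
  No topology is involved: measurability of \<open>B\<close> makes conditioning stay within the set of measures,
  and the separating family turns 0-1 measures into Dirac masses. Full measure of \<open>B\<close> then says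
  that the atom belongs to \<open>B\<close>.
\<close>

theorem extreme_concentrated_measures:
  assumes B: "B \<in> sets M"
    and C: "countable C" "C \<subseteq> sets M"
    and separating: "\<And>x y. x \<in> space M \<Longrightarrow> y \<in> space M \<Longrightarrow> x \<noteq> y \<Longrightarrow> \<exists>U\<in>C. (x \<in> U) \<noteq> (y \<in> U)"
  shows "extreme_measures {\<mu> \<in> space (prob_algebra M). emeasure \<mu> B = 1} = {return M \<omega> | \<omega>. \<omega> \<in> B}"
    (is "extreme_measures ?S = _")
proof (intro equalityI subsetI)
  fix \<mu> assume extreme: "\<mu> \<in> extreme_measures ?S"
  then have sets_eq: "sets \<mu> = sets M" and "prob_space \<mu>" and full: "emeasure \<mu> B = 1"
    by (auto simp: extreme_measures_def space_prob_algebra)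
  have "\<exists>\<omega>\<in>space \<mu>. \<mu> = return \<mu> \<omega>"
    using C separating extreme_measure_zero_one[OF extreme B] sets_eq sets_eq_imp_space_eq[OF sets_eq]
    by (intro zero_one_measure_is_return[OF \<open>prob_space \<mu>\<close>, of C]) auto
  then obtain \<omega> where "\<mu> = return M \<omega>"
    using return_sets_cong[OF sets_eq] by metis
  moreover from this have "\<omega> \<in> B"
    using full B by (simp split: split_indicator_asm)
  ultimately show "\<mu> \<in> {return M \<omega> | \<omega>. \<omega> \<in> B}" by blast
next
  fix \<mu> assume "\<mu> \<in> {return M \<omega> | \<omega>. \<omega> \<in> B}"
  then obtain \<omega> where \<mu>: "\<mu> = return M \<omega>" and \<omega>: "\<omega> \<in> B" by blast
  have space: "\<omega> \<in> space M" using \<omega> sets.sets_into_space[OF B] by auto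
  have "\<mu> \<in> ?S" using \<mu> \<omega> B space by (simp add: space_prob_algebra prob_space_return)
  then show "\<mu> \<in> extreme_measures ?S"
    unfolding extreme_measures_def using \<mu> convex_combination_return[OF space] by blast
qed

section \<open>The trajectory space\<close>

lemma space_borel_of_topology [simp]: "space (borel_of_topology X) = topspace X"
  unfolding borel_of_topology_def using openin_subset by (intro space_measure_of) auto

lemma openin_in_sets_borel_of_topology:
  assumes "openin X U" shows "U \<in> sets (borel_of_topology X)"
proof -
  have "{U. openin X U} \<subseteq> Pow (topspace X)" using openin_subset by auto
  then show ?thesis using assms by (simp add: borel_of_topology_def)
qed

lemma closedin_in_sets_borel_of_topology:
  assumes "closedin X F" shows "F \<in> sets (borel_of_topology X)"
proof -
  have "topspace X - F \<in> sets (borel_of_topology X)"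
    using assms by (intro openin_in_sets_borel_of_topology) (simp add: closedin_def)
  from sets.compl_sets[OF this] show ?thesis
    using closedin_subset[OF assms] by (simp add: double_diff)
qed

lemma topspace_trajectory_topology:
  "topspace (trajectory_topology T)
     = (\<Pi>\<^sub>E _\<in>{0..T}. UNIV) \<times> (\<Pi>\<^sub>E _\<in>{0..<T}. UNIV) \<times> (\<Pi>\<^sub>E _\<in>{0..<T}. UNIV)"
  by (simp add: trajectory_topology_def)

lemma continuous_map_state_at:
  "t \<le> T \<Longrightarrow> continuous_map (trajectory_topology T) euclidean (state_at t)"
  unfolding trajectory_topology_def state_at_def
  by (rule continuous_map_compose[OF continuous_map_fst continuous_map_product_projection,
        unfolded comp_def]) simp

lemma continuous_map_input_at:
  "t < T \<Longrightarrow> continuous_map (trajectory_topology T) euclidean (input_at t)"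
  unfolding trajectory_topology_def input_at_def
  by (rule continuous_map_compose[OF continuous_map_compose[OF continuous_map_snd continuous_map_fst]
        continuous_map_product_projection, unfolded comp_def]) simp

lemma continuous_map_output_at:
  "t < T \<Longrightarrow> continuous_map (trajectory_topology T) euclidean (output_at t)"
  unfolding trajectory_topology_def output_at_def
  by (rule continuous_map_compose[OF continuous_map_compose[OF continuous_map_snd continuous_map_snd]
        continuous_map_product_projection, unfolded comp_def]) simp

text \<open>
  Points of the trajectory space are \<open>undefined\<close> outside the index ranges, so agreement of the
  coordinates within these ranges forces equality.
\<close>

lemma trajectory_eqI:
  assumes "\<omega> \<in> topspace (trajectory_topology T)" and "\<omega>' \<in> topspace (trajectory_topology T)"
    and "\<And>t. t \<le> T \<Longrightarrow> state_at t \<omega> = state_at t \<omega>'"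
    and "\<And>t. t < T \<Longrightarrow> input_at t \<omega> = input_at t \<omega>'"
    and "\<And>t. t < T \<Longrightarrow> output_at t \<omega> = output_at t \<omega>'"
  shows "\<omega> = \<omega>'"
proof (intro prod_eqI)
  show "fst \<omega> = fst \<omega>'"
    using assms by (intro PiE_ext[where k = "{0..T}" and s = "\<lambda>_. UNIV"])
      (auto simp: topspace_trajectory_topology state_at_def)
  show "fst (snd \<omega>) = fst (snd \<omega>')"
    using assms by (intro PiE_ext[where k = "{0..<T}" and s = "\<lambda>_. UNIV"])
      (auto simp: topspace_trajectory_topology input_at_def)
  show "snd (snd \<omega>) = snd (snd \<omega>')"
    using assms by (intro PiE_ext[where k = "{0..<T}" and s = "\<lambda>_. UNIV"])
      (auto simp: topspace_trajectory_topology output_at_def)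
qed

text \<open>
  Pulling back a countable base along each of countably many continuous maps gives countably many
  open sets that tell apart any two points distinguished by one of these maps.
\<close>

lemma countable_open_separating_family:
  fixes g :: "'i \<Rightarrow> 'a \<Rightarrow> 'b::{second_countable_topology, t1_space}"
  assumes "countable I" and cont: "\<And>i. i \<in> I \<Longrightarrow> continuous_map X euclidean (g i)"
  obtains C where "countable C" and "\<And>U. U \<in> C \<Longrightarrow> openin X U"
    and "\<And>x y i. x \<in> topspace X \<Longrightarrow> y \<in> topspace X \<Longrightarrow> i \<in> I \<Longrightarrow> g i x \<noteq> g i y
           \<Longrightarrow> \<exists>U\<in>C. (x \<in> U) \<noteq> (y \<in> U)"
proof -
  obtain D :: "'b set set" where D: "countable D" "topological_basis D"
    using ex_countable_basis by blast
  define C where "C = (\<lambda>(i, V). {x \<in> topspace X. g i x \<in> V}) ` (I \<times> D)"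
  show thesis
  proof (rule that)
    show "countable C" unfolding C_def using \<open>countable I\<close> D(1) by auto
    show "openin X U" if "U \<in> C" for U
      using that D(2) cont unfolding C_def
      by (auto intro!: openin_continuous_map_preimage simp: topological_basis_open)
    fix x y i
    assume x: "x \<in> topspace X" and y: "y \<in> topspace X" and i: "i \<in> I" and "g i x \<noteq> g i y"
    then obtain W where "open W" "g i x \<in> W" "g i y \<notin> W" using t1_space by blast
    then obtain V where "V \<in> D" "g i x \<in> V" "g i y \<notin> V"
      using topological_basisE[OF D(2)] by (metis subsetD)
    then show "\<exists>U\<in>C. (x \<in> U) \<noteq> (y \<in> U)"
      using x i unfolding C_def by (intro bexI[of _ "{x \<in> topspace X. g i x \<in> V}"]) auto
  qed
qed

lemma trajectory_separating_family:
  obtains C :: "('x::polish_space, 'u::polish_space, 'y::polish_space) trajectory set set"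
  where "countable C" and "\<And>U. U \<in> C \<Longrightarrow> openin (trajectory_topology T) U"
    and "\<And>\<omega> \<omega>'. \<omega> \<in> topspace (trajectory_topology T) \<Longrightarrow> \<omega>' \<in> topspace (trajectory_topology T)
           \<Longrightarrow> \<omega> \<noteq> \<omega>' \<Longrightarrow> \<exists>U\<in>C. (\<omega> \<in> U) \<noteq> (\<omega>' \<in> U)"
proof -
  let ?X = "trajectory_topology T :: ('x, 'u, 'y) trajectory topology"
  obtain Cx where Cx: "countable Cx" "\<And>U. U \<in> Cx \<Longrightarrow> openin ?X U"
    "\<And>\<omega> \<omega>' t. \<omega> \<in> topspace ?X \<Longrightarrow> \<omega>' \<in> topspace ?X \<Longrightarrow> t \<in> {..T} \<Longrightarrow> state_at t \<omega> \<noteq> state_at t \<omega>'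
       \<Longrightarrow> \<exists>U\<in>Cx. (\<omega> \<in> U) \<noteq> (\<omega>' \<in> U)"
    by (rule countable_open_separating_family[of "{..T}" ?X state_at])
      (auto intro: continuous_map_state_at)
  obtain Cu where Cu: "countable Cu" "\<And>U. U \<in> Cu \<Longrightarrow> openin ?X U"
    "\<And>\<omega> \<omega>' t. \<omega> \<in> topspace ?X \<Longrightarrow> \<omega>' \<in> topspace ?X \<Longrightarrow> t \<in> {..<T} \<Longrightarrow> input_at t \<omega> \<noteq> input_at t \<omega>'
       \<Longrightarrow> \<exists>U\<in>Cu. (\<omega> \<in> U) \<noteq> (\<omega>' \<in> U)"
    by (rule countable_open_separating_family[of "{..<T}" ?X input_at])
      (auto intro: continuous_map_input_at)
  obtain Cy where Cy: "countable Cy" "\<And>U. U \<in> Cy \<Longrightarrow> openin ?X U"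
    "\<And>\<omega> \<omega>' t. \<omega> \<in> topspace ?X \<Longrightarrow> \<omega>' \<in> topspace ?X \<Longrightarrow> t \<in> {..<T} \<Longrightarrow> output_at t \<omega> \<noteq> output_at t \<omega>'
       \<Longrightarrow> \<exists>U\<in>Cy. (\<omega> \<in> U) \<noteq> (\<omega>' \<in> U)"
    by (rule countable_open_separating_family[of "{..<T}" ?X output_at])
      (auto intro: continuous_map_output_at)
  show thesis
  proof (rule that[of "Cx \<union> Cu \<union> Cy"])
    show "countable (Cx \<union> Cu \<union> Cy)" using Cx(1) Cu(1) Cy(1) by simp
    show "openin ?X U" if "U \<in> Cx \<union> Cu \<union> Cy" for U using that Cx(2) Cu(2) Cy(2) by blast
    fix \<omega> \<omega>' assume mem: "\<omega> \<in> topspace ?X" "\<omega>' \<in> topspace ?X" and "\<omega> \<noteq> \<omega>'"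
    then consider t where "t \<in> {..T}" "state_at t \<omega> \<noteq> state_at t \<omega>'"
      | t where "t \<in> {..<T}" "input_at t \<omega> \<noteq> input_at t \<omega>'"
      | t where "t \<in> {..<T}" "output_at t \<omega> \<noteq> output_at t \<omega>'"
      using trajectory_eqI[OF mem] by auto
    then show "\<exists>U\<in>Cx \<union> Cu \<union> Cy. (\<omega> \<in> U) \<noteq> (\<omega>' \<in> U)"
      by cases (use Cx(3)[OF mem] Cu(3)[OF mem] Cy(3)[OF mem] in blast)+
  qed
qed

lemma Hausdorff_space_euclidean_t2: "Hausdorff_space (euclidean :: 'a::t2_space topology)"
  unfolding Hausdorff_space_def disjnt_def by (simp add: separation_t2)

lemma closedin_admissible_paths:
  fixes f :: "'x::t2_space \<times> 'u::topological_space \<Rightarrow> 'x" and h :: "'x \<times> 'u \<Rightarrow> 'y::t2_space"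
  assumes f: "continuous_on UNIV f" and h: "continuous_on UNIV h"
  shows "closedin (trajectory_topology T) (admissible_paths T f h)"
proof -
  let ?X = "trajectory_topology T :: ('x, 'u, 'y) trajectory topology"
  define E where "E t = {\<omega> \<in> topspace ?X. state_at (Suc t) \<omega> = f (state_at t \<omega>, input_at t \<omega>)}
    \<inter> {\<omega> \<in> topspace ?X. output_at t \<omega> = h (state_at t \<omega>, input_at t \<omega>)}" for t
  have closed: "closedin ?X (E t)" if t: "t < T" for t
  proof -
    have "continuous_map ?X (prod_topology euclidean euclidean) (\<lambda>\<omega>. (state_at t \<omega>, input_at t \<omega>))"
      using t by (intro continuous_map_pairedI continuous_map_state_at continuous_map_input_at) auto
    then have pair: "continuous_map ?X euclidean (\<lambda>\<omega>. (state_at t \<omega>, input_at t \<omega>))" by simp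
    have "continuous_map ?X euclidean (\<lambda>\<omega>. f (state_at t \<omega>, input_at t \<omega>))"
      "continuous_map ?X euclidean (\<lambda>\<omega>. h (state_at t \<omega>, input_at t \<omega>))"
      using continuous_map_compose[OF pair, of euclidean f]
        continuous_map_compose[OF pair, of euclidean h] f h
      by (simp_all add: comp_def)
    then show ?thesis unfolding E_def using t
      by (intro closedin_Int closedin_continuous_maps_eq[where Y = euclidean]
          continuous_map_state_at continuous_map_output_at Hausdorff_space_euclidean_t2) auto
  qed
  \<comment> \<open>The whole space is added as a member to cover \<open>T = 0\<close>, where there are no equations.\<close>
  have "admissible_paths T f h = \<Inter> (insert (topspace ?X) (E ` {..<T}))"
    by (auto simp: admissible_paths_def E_def)
  also have "closedin ?X \<dots>"
    using closed by (intro closedin_Inter) auto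
  finally show ?thesis .
qed

theorem proposition2p9:
  fixes T :: nat
    and f :: "'x::polish_space \<times> 'u::polish_space \<Rightarrow> 'x"
    and h :: "'x \<times> 'u \<Rightarrow> 'y::polish_space"
  assumes "continuous_on UNIV f"
    and "continuous_on UNIV h"
  shows "extreme_measures (behavioral_measures T f h) =
    {return (borel_of_topology (trajectory_topology T)) \<omega> | \<omega>. \<omega> \<in> admissible_paths T f h}"
proof -
  let ?X = "trajectory_topology T :: ('x, 'u, 'y) trajectory topology"
  obtain C where C: "countable C" "\<And>U. U \<in> C \<Longrightarrow> openin ?X U"
    and separating: "\<And>\<omega> \<omega>'. \<omega> \<in> topspace ?X \<Longrightarrow> \<omega>' \<in> topspace ?X \<Longrightarrow> \<omega> \<noteq> \<omega>'
      \<Longrightarrow> \<exists>U\<in>C. (\<omega> \<in> U) \<noteq> (\<omega>' \<in> U)"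
    using trajectory_separating_family by blast
  have "admissible_paths T f h \<in> sets (borel_of_topology ?X)"
    using closedin_admissible_paths[OF assms] by (rule closedin_in_sets_borel_of_topology)
  moreover have "C \<subseteq> sets (borel_of_topology ?X)"
    using C(2) openin_in_sets_borel_of_topology by blast
  ultimately show ?thesis
    unfolding behavioral_measures_def borel_probability_measures_def
    using C(1) separating by (intro extreme_concentrated_measures[of _ _ C]) simp_all
qed

end
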